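(* Let $a=(a_n)_{n\in\mathbb{N}_0}\in\ell_2(\mathbb{N}_0)$ be non-negative and non-increasing. Define $\gamma\in\ell_2(\mathbb{Z})$ by $\gamma=(\dots,a_3,a_1,a_0,a_2,a_4,\dots)$, i.e. $\gamma_k=a_{2k}$ for $k\ge 0$ and $\gamma_{-k}=a_{2k-1}$ for $k\ge 1$. Then $a_n(H_\gamma,L_2)=a_n$ for all $n\in\mathbb{N}_0$, and $$g_n(H_\gamma,L_2)^2\;\ge\;\frac{1}{8n}\sum_{k\ge n}a_k(H_\gamma,L_2)^2$$ for infinitely many values of $n\in\mathbb{N}$.
   Context: Put $e_j(x)=e^{2\pi i j x}$ for $j\in\mathbb{Z}$, $x\in\mathbb{R}$. For a non-negative sequence $\gamma=(\gamma_j)_{j\in\mathbb{Z}}\in\ell_2(\mathbb{Z})$, $H_\gamma$ denotes the (complex) Hilbert space of all 1-periodic functions $f(x)=\sum_{j\in\mathbb{Z}}\alpha_j e_j(x)$, $x\in[0,1]$, such that $\alpha_j=0$ whenever $\gamma_j=0$ and $\|f\|_{H_\gamma}^2=\sum_{j:\gamma_j\neq 0}|\alpha_j|^2/\gamma_j^2<\infty$. The series converges absolutely and uniformly, and $H_\gamma$ is a reproducing kernel Hilbert space of continuous functions. $L_2=L_2([0,1])$ with Lebesgue measure and norm $\|\cdot\|_2$. For $n\in\mathbb{N}_0$, the approximation numbers are $a_n(H_\gamma,L_2)=\inf_{A_n}\sup_{\|f\|_{H_\gamma}\le1}\|f-A_n(f)\|_2$, where the infimum is over all $A_n(f)=\sum_{i=1}^nL_i(f)g_i$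 with linear functionals $L_i$ on $H_\gamma$ and $g_i\in L_2$. The sampling numbers are $g_n(H_\gamma,L_2)=\inf_{S_n}\sup_{\|f\|_{H_\gamma}\le1}\|f-S_n(f)\|_2$, where the infimum is over all $S_n(f)=\sum_{i=1}^nf(x_i)g_i$ with points $x_i\in[0,1]$ and $g_i\in L_2$. *)

theory Defs
  imports "HOL-Analysis.Analysis"
begin

definition trig :: "int \<Rightarrow> real \<Rightarrow> complex" where
  "trig j x = exp (2 * of_real pi * \<i> * of_int j * of_real x)"

definition coeffs_of :: "(int \<Rightarrow> real) \<Rightarrow> (real \<Rightarrow> complex) \<Rightarrow> (int \<Rightarrow> complex) \<Rightarrow> bool" where
  "coeffs_of \<gamma> f \<alpha> \<longleftrightarrow>
     (\<forall>j. \<gamma> j = 0 \<longrightarrow> \<alpha> j = 0) \<and>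
     (\<lambda>j. (cmod (\<alpha> j))\<^sup>2 / (\<gamma> j)\<^sup>2) summable_on {j. \<gamma> j \<noteq> 0} \<and>
     (\<forall>x. ((\<lambda>j. \<alpha> j * trig j x) has_sum f x) UNIV)"

text \<open>Elements of \<open>H_space \<gamma>\<close> are functions on the whole real line; 1-periodicity is
  automatic because every \<open>trig j\<close> is 1-periodic.\<close>

definition H_space :: "(int \<Rightarrow> real) \<Rightarrow> (real \<Rightarrow> complex) set" where
  "H_space \<gamma> = {f. \<exists>\<alpha>. coeffs_of \<gamma> f \<alpha>}"

definition H_norm :: "(int \<Rightarrow> real) \<Rightarrow> (real \<Rightarrow> complex) \<Rightarrow> real" where
  "H_norm \<gamma> f =
     (let \<alpha> = (THE \<alpha>. coeffs_of \<gamma> f \<alpha>)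
      in sqrt (\<Sum>\<^sub>\<infinity>j\<in>{j. \<gamma> j \<noteq> 0}. (cmod (\<alpha> j))\<^sup>2 / (\<gamma> j)\<^sup>2))"

text \<open>The description in \<open>H_norm\<close> is proper: the coefficients are determined by the function.\<close>

lemma trig_has_integral:
  "(trig m has_integral (if m = 0 then 1 else 0)) {0..1}"
proof (cases "m = 0")
  case True
  then have "trig m = (\<lambda>_. 1)" by (auto simp: trig_def)
  then show ?thesis using True has_integral_const_real[of "1::complex" 0 1] by simp
next
  case False
  define c :: complex where "c = 2 * of_real pi * \<i> * of_int m"
  have c: "c \<noteq> 0" using False by (simp add: c_def)
  have tr: "trig m x = exp (c * of_real x)" for x by (simp add: trig_def c_def)
  have "((\<lambda>x. exp (c * of_real x)) has_integral
          (exp (c * of_real 1) / c - exp (c * of_real 0) / c)) {0..1}"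
  proof (rule fundamental_theorem_of_calculus)
    fix x :: real
    have "((\<lambda>z. exp (c * z) / c) has_field_derivative exp (c * of_real x)) (at (of_real x))"
      using c by (auto intro!: derivative_eq_intros)
    then show "((\<lambda>x. exp (c * of_real x) / c) has_vector_derivative exp (c * of_real x))
            (at x within {0..1})"
      by (rule has_vector_derivative_real_field)
  qed simp
  moreover have "exp c = 1"
    unfolding c_def exp_eq_1 by simp
  ultimately show ?thesis using False by (simp add: tr[abs_def])
qed

lemma trig_mult: "trig j x * trig k x = trig (j + k) x"
  by (simp add: trig_def exp_add[symmetric] algebra_simps)

lemma coeffs_of_unique:
  assumes "coeffs_of \<gamma> f \<alpha>" "coeffs_of \<gamma> f \<beta>"
  shows "\<alpha> = \<beta>"
proof
  fix k
  define d where "d = (\<lambda>j. \<alpha> j - \<beta> j)"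
  have d0: "((\<lambda>j. d j * trig j x) has_sum 0) UNIV" for x
  proof -
    have "((\<lambda>j. \<alpha> j * trig j x) has_sum f x) UNIV" "((\<lambda>j. \<beta> j * trig j x) has_sum f x) UNIV"
      using assms by (auto simp: coeffs_of_def)
    from has_sum_add[OF this(1) has_sum_cmult_right[OF this(2), of "-1"]]
    show ?thesis by (simp add: d_def algebra_simps)
  qed
  have "(\<lambda>j. d j) summable_on UNIV"
    using d0[of 0] by (auto simp: trig_def summable_on_def)
  then have abs: "(\<lambda>j. cmod (d j)) summable_on UNIV"
    by (simp add: summable_on_iff_abs_summable_on_complex)
  have nrm: "cmod (trig j x) = 1" for j x by (simp add: trig_def)
  have "uniform_limit {0..1} (\<lambda>X x. \<Sum>j\<in>X. d j * trig (j - k) x) (\<lambda>_. 0)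
          (finite_subsets_at_top UNIV)"
  proof (rule Weierstrass_m_test_general')
    show "((\<lambda>j. d j * trig (j - k) x) has_sum 0) UNIV" for x
      using has_sum_cmult_left[OF d0[of x], of "trig (- k) x"]
      by (simp add: trig_mult mult.assoc)
    show "(\<lambda>j. cmod (d j)) summable_on UNIV" by (rule abs)
  qed (simp add: norm_mult nrm)
  then obtain I J where IJ:
    "\<And>X. ((\<lambda>x. \<Sum>j\<in>X. d j * trig (j - k) x) has_integral I X) {0..1}"
    "((\<lambda>_. 0) has_integral J) {0..(1::real)}"
    "(I \<longlongrightarrow> J) (finite_subsets_at_top UNIV)"
    by (rule uniform_limit_integral)
       (auto simp: trig_def intro!: continuous_intros)
  have J: "J = 0" using IJ(2) has_integral_unique has_integral_0 by blast
  have I: "I X = d k" if "finite X" "k \<in> X" for X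
  proof -
    have "((\<lambda>x. \<Sum>j\<in>X. d j * trig (j - k) x) has_integral
            (\<Sum>j\<in>X. d j * (if j - k = 0 then 1 else 0))) {0..1}"
      by (intro has_integral_sum that has_integral_mult_right trig_has_integral)
    moreover have "(\<Sum>j\<in>X. d j * (if j - k = 0 then 1 else 0)) = d k"
      using that by (simp add: if_distrib[of "(*) _"] sum.delta cong: if_cong)
    ultimately show ?thesis using IJ(1) has_integral_unique by metis
  qed
  have "\<forall>\<^sub>F X in finite_subsets_at_top UNIV. I X = d k"
    unfolding eventually_finite_subsets_at_top using I by (intro exI[of _ "{k}"]) auto
  then have "(I \<longlongrightarrow> d k) (finite_subsets_at_top UNIV)"
    by (rule tendsto_eventually)
  then have "d k = J" using IJ(3) tendsto_unique finite_subsets_at_top_neq_bot by blast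
  then show "\<alpha> k = \<beta> k" using J by (simp add: d_def)
qed

lemma H_norm_eq:
  assumes "coeffs_of \<gamma> f \<alpha>"
  shows "H_norm \<gamma> f = sqrt (\<Sum>\<^sub>\<infinity>j\<in>{j. \<gamma> j \<noteq> 0}. (cmod (\<alpha> j))\<^sup>2 / (\<gamma> j)\<^sup>2)"
proof -
  have "(THE \<alpha>. coeffs_of \<gamma> f \<alpha>) = \<alpha>"
    using assms coeffs_of_unique by blast
  then show ?thesis by (simp add: H_norm_def)
qed

definition L2_space :: "(real \<Rightarrow> complex) set" where
  "L2_space = {g \<in> borel_measurable (lebesgue_on {0..1}).
     integrable (lebesgue_on {0..1}) (\<lambda>x. (cmod (g x))\<^sup>2)}"

definition L2_norm :: "(real \<Rightarrow> complex) \<Rightarrow> real" where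
  "L2_norm g = sqrt (LINT x|lebesgue_on {0..1}. (cmod (g x))\<^sup>2)"

definition linear_functional :: "(int \<Rightarrow> real) \<Rightarrow> ((real \<Rightarrow> complex) \<Rightarrow> complex) \<Rightarrow> bool" where
  "linear_functional \<gamma> L \<longleftrightarrow>
     (\<forall>f\<in>H_space \<gamma>. \<forall>h\<in>H_space \<gamma>. L (\<lambda>x. f x + h x) = L f + L h) \<and>
     (\<forall>c. \<forall>f\<in>H_space \<gamma>. L (\<lambda>x. c * f x) = c * L f)"

text \<open>Worst-case errors live in \<^typ>\<open>ennreal\<close>, since no boundedness of the functionals is
  required and the supremum over the unit ball may then be infinite.\<close>

definition worst_case_error ::
  "(int \<Rightarrow> real) \<Rightarrow> ((real \<Rightarrow> complex) \<Rightarrow> real \<Rightarrow> complex) \<Rightarrow> ennreal" where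
  "worst_case_error \<gamma> A =
     (SUP f\<in>{f \<in> H_space \<gamma>. H_norm \<gamma> f \<le> 1}. ennreal (L2_norm (\<lambda>x. f x - A f x)))"

definition approximation_number :: "(int \<Rightarrow> real) \<Rightarrow> nat \<Rightarrow> ennreal" where
  "approximation_number \<gamma> n =
     (INF (L, g) \<in> {(L, g). \<forall>i<n. linear_functional \<gamma> (L i) \<and> g i \<in> L2_space}.
        worst_case_error \<gamma> (\<lambda>f x. \<Sum>i<n. L i f * g i x))"

definition sampling_number :: "(int \<Rightarrow> real) \<Rightarrow> nat \<Rightarrow> ennreal" where
  "sampling_number \<gamma> n =
     (INF (t, g) \<in> {(t, g). \<forall>i<n. t i \<in> {0..1} \<and> g i \<in> L2_space}.
        worst_case_error \<gamma> (\<lambda>f x. \<Sum>i<n. f (t i) * g i x))"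

end

theory Submission
  imports Defs
begin

text \<open>Every sampling algorithm with \<open>n\<close> nodes induces a quadrature rule with weights
  \<open>c i = \<integral> g i\<close>, and its quadrature error at \<open>f\<close> is at most its \<open>L\<^sub>2\<close> error at \<open>f\<close>. If
  \<open>0 \<le> \<mu> j \<le> (\<gamma> j)\<^sup>2\<close>, then testing on the Riesz representer of the quadrature error with
  respect to the kernel with spectrum \<open>\<mu>\<close> bounds the squared worst-case error from below by
  \<open>\<Sum>j. \<mu> j * \<bar>[j = 0] - P j\<bar>\<^sup>2\<close>, where \<open>P j = \<Sum>i<n. c i * trig j (t i)\<close>.

  When \<open>\<mu>\<close> is the spectrum of a Fejer kernel, \<open>\<Sum>j. \<mu> j * \<bar>P j\<bar>\<^sup>2\<close> is, up to scaling, the squared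
  Frobenius norm of the Toeplitz matrix \<open>(P (r - s))\<close>. This matrix has rank at most \<open>n\<close>, so
  \<open>\<bar>tr A\<bar>\<^sup>2 \<le> rank A * \<parallel>A\<parallel>\<^sup>2\<close> yields
  \<open>\<Sum>j. \<mu> j * \<bar>P j\<bar>\<^sup>2 \<ge> (\<Sum>j. \<mu> j) / n * \<bar>P 0\<bar>\<^sup>2\<close>; the same then holds for mixtures of Fejer kernels,
  and minimising over \<open>P 0\<close> gives the lower bound \<open>c - c\<^sup>2 * n / (\<Sum>j. \<mu> j)\<close> with \<open>c = \<mu> 0\<close>.

  Let \<open>T\<close> be a partial sum of \<open>\<Sum>k\<ge>n. (a k)\<^sup>2\<close> and \<open>c = T / (4 * n)\<close>. If \<open>(a n)\<^sup>2 \<ge> c\<close>, the bound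
  \<open>g\<^sub>n \<ge> a n\<close> suffices. Otherwise capping the spectrum at \<open>c\<close> leaves a mass of at least \<open>T\<close>, and it
  dominates a mixture of Fejer triangles with value \<open>c\<close> at \<open>0\<close> and total mass at least \<open>T / 2\<close>.\<close>

subsection \<open>The rank-trace inequality\<close>

text \<open>Gram-Schmidt, one vector at a time: P is the orthogonal projection of the space of
  functions on R onto the span of the \<open>v i\<close>. Its trace is its rank, hence at most
  n.\<close>

lemma ex_projection_matrix:
  fixes v :: "nat \<Rightarrow> 'r \<Rightarrow> complex"
  assumes "finite R"
  shows "\<exists>P. (\<forall>r\<in>R. \<forall>s\<in>R. cnj (P r s) = P s r) \<and>
    (\<forall>r\<in>R. \<forall>t\<in>R. (\<Sum>s\<in>R. P r s * P s t) = P r t) \<and>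
    Re (\<Sum>r\<in>R. P r r) \<le> real n \<and>
    (\<forall>i<n. \<forall>r\<in>R. (\<Sum>s\<in>R. P r s * v i s) = v i r)"
proof (induction n)
  case 0
  show ?case by (rule exI[of _ "\<lambda>_ _. 0"]) simp
next
  case (Suc n)
  then obtain P where herm: "\<And>r s. r \<in> R \<Longrightarrow> s \<in> R \<Longrightarrow> cnj (P r s) = P s r"
    and idem: "\<And>r t. r \<in> R \<Longrightarrow> t \<in> R \<Longrightarrow> (\<Sum>s\<in>R. P r s * P s t) = P r t"
    and tr: "Re (\<Sum>r\<in>R. P r r) \<le> real n"
    and fix_v: "\<And>i r. i < n \<Longrightarrow> r \<in> R \<Longrightarrow> (\<Sum>s\<in>R. P r s * v i s) = v i r"
    by blast
  \<comment> \<open>The component of \<open>v n\<close> orthogonal to the range of P; W is its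
    squared norm.\<close>
  define w where "w r = v n r - (\<Sum>s\<in>R. P r s * v n s)" for r
  define W where "W = (\<Sum>r\<in>R. (cmod (w r))\<^sup>2)"
  have Pw: "(\<Sum>s\<in>R. P r s * w s) = 0" if "r \<in> R" for r
  proof -
    have "(\<Sum>s\<in>R. P r s * (\<Sum>t\<in>R. P s t * v n t)) = (\<Sum>t\<in>R. \<Sum>s\<in>R. P r s * (P s t * v n t))"
      by (subst sum.swap) (simp add: sum_distrib_left)
    also have "\<dots> = (\<Sum>t\<in>R. (\<Sum>s\<in>R. P r s * P s t) * v n t)"
      by (simp add: sum_distrib_right mult.assoc)
    also have "\<dots> = (\<Sum>t\<in>R. P r t * v n t)"
      using that by (intro sum.cong refl) (simp add: idem)
    finally show ?thesis by (simp add: w_def right_diff_distrib sum_subtractf)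
  qed
  have wP: "(\<Sum>r\<in>R. cnj (w r) * P r s) = 0" if "s \<in> R" for s
  proof -
    have "(\<Sum>r\<in>R. cnj (w r) * P r s) = cnj (\<Sum>r\<in>R. P s r * w r)"
      using that by (simp add: herm mult.commute)
    then show ?thesis using Pw[OF that] by simp
  qed
  have ww: "(\<Sum>r\<in>R. cnj (w r) * w r) = of_real W"
    unfolding W_def of_real_sum by (intro sum.cong refl) (simp only: complex_norm_square mult.commute)
  show ?case
  proof (cases "W = 0")
    \<comment> \<open>Here \<open>v n\<close> already lies in the range of P, so P itself serves for
      \<open>Suc n\<close>.\<close>
    case True
    then have "w r = 0" if "r \<in> R" for r
      using that assms by (simp add: W_def sum_nonneg_eq_0_iff)
    then have "(\<Sum>s\<in>R. P r s * v n s) = v n r" if "r \<in> R" for r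
      using that by (simp add: w_def)
    then show ?thesis
      using herm idem tr fix_v by (intro exI[of _ P]) (auto simp: less_Suc_eq)
  next
    case False
    \<comment> \<open>Adding the orthogonal projection onto the line spanned by w raises the trace
      by exactly one.\<close>
    define Q where "Q r s = P r s + w r * cnj (w s) / of_real W" for r s
    have orth: "(\<Sum>s\<in>R. cnj (w s) * (\<Sum>t\<in>R. P s t * x t)) = 0" for x
    proof -
      have "(\<Sum>s\<in>R. cnj (w s) * (\<Sum>t\<in>R. P s t * x t)) = (\<Sum>t\<in>R. \<Sum>s\<in>R. cnj (w s) * P s t * x t)"
        by (subst sum.swap) (simp add: sum_distrib_left mult.assoc)
      also have "\<dots> = (\<Sum>t\<in>R. (\<Sum>s\<in>R. cnj (w s) * P s t) * x t)"
        by (simp add: sum_distrib_right)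
      finally show ?thesis using wP by simp
    qed
    have Qx: "(\<Sum>s\<in>R. Q r s * x s) = (\<Sum>s\<in>R. P r s * x s) + w r * (\<Sum>s\<in>R. cnj (w s) * x s) / of_real W"
      for r x
      by (simp add: Q_def distrib_right sum.distrib sum_distrib_left sum_divide_distrib mult.assoc)
    have "cnj (Q r s) = Q s r" if "r \<in> R" "s \<in> R" for r s
      using that by (simp add: Q_def herm mult.commute)
    moreover have "(\<Sum>s\<in>R. Q r s * Q s t) = Q r t" if "r \<in> R" "t \<in> R" for r t
    proof -
      have "(\<Sum>s\<in>R. P r s * Q s t) = (\<Sum>s\<in>R. P r s * P s t) + (\<Sum>s\<in>R. P r s * w s) * (cnj (w t) / of_real W)"
        unfolding sum_distrib_right by (simp add: Q_def algebra_simps sum.distrib)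
      moreover have "(\<Sum>s\<in>R. cnj (w s) * Q s t) = (\<Sum>s\<in>R. cnj (w s) * P s t)
          + (\<Sum>s\<in>R. cnj (w s) * w s) * (cnj (w t) / of_real W)"
        unfolding sum_distrib_right by (simp add: Q_def algebra_simps sum.distrib)
      ultimately show ?thesis
        using that False unfolding Qx by (simp add: idem Pw wP ww Q_def)
    qed
    moreover have "Re (\<Sum>r\<in>R. Q r r) \<le> real (Suc n)"
    proof -
      have "(\<Sum>r\<in>R. Q r r) = (\<Sum>r\<in>R. P r r) + (\<Sum>r\<in>R. cnj (w r) * w r) / of_real W"
        by (simp add: Q_def sum.distrib sum_divide_distrib mult.commute)
      then show ?thesis using tr False by (simp add: ww)
    qed
    moreover have "(\<Sum>s\<in>R. Q r s * v i s) = v i r" if "i < Suc n" "r \<in> R" for i r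
    proof (cases "i = n")
      case True
      have "(\<Sum>s\<in>R. cnj (w s) * v n s)
          = (\<Sum>s\<in>R. cnj (w s) * w s) + (\<Sum>s\<in>R. cnj (w s) * (\<Sum>t\<in>R. P s t * v n t))"
        by (simp add: w_def algebra_simps flip: sum.distrib)
      then show ?thesis using True False by (simp add: Qx orth ww) (simp add: w_def)
    next
      case neq: False
      then have "i < n" using that by simp
      then have "(\<Sum>s\<in>R. cnj (w s) * v i s) = (\<Sum>s\<in>R. cnj (w s) * (\<Sum>t\<in>R. P s t * v i t))"
        by (intro sum.cong refl) (simp add: fix_v)
      then have "(\<Sum>s\<in>R. cnj (w s) * v i s) = 0"
        by (simp only: orth)
      then show ?thesis using \<open>i < n\<close> that by (simp add: Qx fix_v)
    qed
    ultimately show ?thesis by blast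
  qed
qed

text \<open>The columns of the matrix A lie in the span of the \<open>v i\<close>, so A = PA for the
  projection P onto this span. Cauchy-Schwarz applied to the trace of PA leaves the squared
  Frobenius norm of P, which equals its trace and is at most n.\<close>

lemma rank_trace_inequality:
  fixes v u :: "nat \<Rightarrow> 'r \<Rightarrow> complex"
  assumes R: "finite R"
  shows "(cmod (\<Sum>r\<in>R. \<Sum>i<n. v i r * u i r))\<^sup>2
    \<le> real n * (\<Sum>r\<in>R. \<Sum>s\<in>R. (cmod (\<Sum>i<n. v i r * u i s))\<^sup>2)"
proof -
  define A where "A r s = (\<Sum>i<n. v i r * u i s)" for r s
  obtain P where herm: "\<And>r s. r \<in> R \<Longrightarrow> s \<in> R \<Longrightarrow> cnj (P r s) = P s r"
    and idem: "\<And>r t. r \<in> R \<Longrightarrow> t \<in> R \<Longrightarrow> (\<Sum>s\<in>R. P r s * P s t) = P r t"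
    and tr: "Re (\<Sum>r\<in>R. P r r) \<le> real n"
    and fix_v: "\<And>i r. i < n \<Longrightarrow> r \<in> R \<Longrightarrow> (\<Sum>s\<in>R. P r s * v i s) = v i r"
    using ex_projection_matrix[OF R, of n v] by blast
  have PA: "(\<Sum>t\<in>R. P r t * A t s) = A r s" if "r \<in> R" for r s
  proof -
    have "(\<Sum>t\<in>R. P r t * A t s) = (\<Sum>i<n. (\<Sum>t\<in>R. P r t * v i t) * u i s)"
      unfolding A_def sum_distrib_left sum_distrib_right
      by (subst sum.swap) (simp add: mult.assoc)
    then show ?thesis using that by (simp add: fix_v A_def)
  qed
  \<comment> \<open>Row by row, the squared Frobenius norm of P becomes the trace of P times P,
    because P is Hermitian; idempotence then gives the trace of P.\<close>
  have "of_real (\<Sum>s\<in>R. (cmod (P r s))\<^sup>2) = (\<Sum>s\<in>R. P r s * P s r)" if "r \<in> R" for r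
    unfolding of_real_sum using that
    by (intro sum.cong refl) (simp only: complex_norm_square herm)
  then have "of_real (\<Sum>r\<in>R. \<Sum>s\<in>R. (cmod (P r s))\<^sup>2) = (\<Sum>r\<in>R. P r r)"
    unfolding of_real_sum[of _ R] by (intro sum.cong refl) (simp add: idem)
  from arg_cong[OF this, of Re] tr
  have P_le: "(\<Sum>r\<in>R. \<Sum>s\<in>R. (cmod (P r s))\<^sup>2) \<le> real n"
    by (simp only: Re_complex_of_real)
  have "cmod (\<Sum>r\<in>R. A r r) = cmod (\<Sum>(r, s)\<in>R \<times> R. P r s * A s r)"
    using R by (simp add: PA flip: sum.cartesian_product)
  also have "\<dots> \<le> (\<Sum>(r, s)\<in>R \<times> R. cmod (P r s) * cmod (A s r))"
    by (rule order_trans[OF norm_sum]) (simp add: case_prod_unfold norm_mult)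
  finally have "(cmod (\<Sum>r\<in>R. A r r))\<^sup>2 \<le> (\<Sum>(r, s)\<in>R \<times> R. cmod (P r s) * cmod (A s r))\<^sup>2"
    by (rule power_mono) simp
  also have "\<dots> \<le> (\<Sum>(r, s)\<in>R \<times> R. (cmod (P r s))\<^sup>2) * (\<Sum>(r, s)\<in>R \<times> R. (cmod (A s r))\<^sup>2)"
    using Cauchy_Schwarz_ineq_sum[of "\<lambda>(r, s). cmod (P r s)" "\<lambda>(r, s). cmod (A s r)" "R \<times> R"]
    by (simp add: case_prod_unfold)
  also have "(\<Sum>(r, s)\<in>R \<times> R. (cmod (A s r))\<^sup>2) = (\<Sum>r\<in>R. \<Sum>s\<in>R. (cmod (A r s))\<^sup>2)"
    by (subst sum.swap) (simp add: sum.cartesian_product)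
  also have "(\<Sum>(r, s)\<in>R \<times> R. (cmod (P r s))\<^sup>2) = (\<Sum>r\<in>R. \<Sum>s\<in>R. (cmod (P r s))\<^sup>2)"
    by (simp add: sum.cartesian_product)
  also have "\<dots> * (\<Sum>r\<in>R. \<Sum>s\<in>R. (cmod (A r s))\<^sup>2) \<le> real n * (\<Sum>r\<in>R. \<Sum>s\<in>R. (cmod (A r s))\<^sup>2)"
    by (intro mult_right_mono P_le sum_nonneg) simp
  finally show ?thesis by (simp add: A_def)
qed

text \<open>If P projects onto the span of the conjugated rows of b, every column of the identity
  minus P solves the system. Not all of these columns vanish, because the trace of P is at most n
  and hence below \<open>card R\<close>.\<close>

lemma ex_nonzero_annihilated:
  fixes b :: "nat \<Rightarrow> 'r \<Rightarrow> complex"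
  assumes "finite R" "n < card R"
  obtains x where "\<exists>r\<in>R. x r \<noteq> 0" "\<And>i. i < n \<Longrightarrow> (\<Sum>r\<in>R. b i r * x r) = 0"
proof -
  obtain P where herm: "\<And>r s. r \<in> R \<Longrightarrow> s \<in> R \<Longrightarrow> cnj (P r s) = P s r"
    and tr: "Re (\<Sum>r\<in>R. P r r) \<le> real n"
    and fix_b: "\<And>i r. i < n \<Longrightarrow> r \<in> R \<Longrightarrow> (\<Sum>s\<in>R. P r s * cnj (b i s)) = cnj (b i r)"
    using ex_projection_matrix[OF assms(1), of n "\<lambda>i r. cnj (b i r)"] by blast
  have "\<exists>s\<in>R. P s s \<noteq> 1"
  proof (rule ccontr)
    assume "\<not> (\<exists>s\<in>R. P s s \<noteq> 1)"
    then have "(\<Sum>r\<in>R. P r r) = of_nat (card R)" by simp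
    then show False using tr assms(2) by simp
  qed
  then obtain s where s: "s \<in> R" "P s s \<noteq> 1" by blast
  show ?thesis
  proof
    show "\<exists>r\<in>R. (if r = s then 1 else 0) - P r s \<noteq> 0" using s by auto
    fix i assume "i < n"
    have "(\<Sum>r\<in>R. b i r * P r s) = cnj (\<Sum>r\<in>R. P s r * cnj (b i r))"
      using s by (simp add: herm mult.commute)
    also have "\<dots> = b i s" using \<open>i < n\<close> s by (simp add: fix_b)
    finally show "(\<Sum>r\<in>R. b i r * ((if r = s then 1 else 0) - P r s)) = 0"
      using s assms(1) by (simp add: right_diff_distrib sum_subtractf if_distrib[of "(*) _"] cong: if_cong)
  qed
qed

subsection \<open>Absolutely convergent trigonometric series\<close>

lemma cmod_trig [simp]: "cmod (trig j x) = 1"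
  by (simp add: trig_def)

lemma cnj_trig: "cnj (trig j x) = trig (- j) x"
  by (simp add: trig_def exp_cnj)

lemma trig_zero [simp]: "trig 0 x = 1"
  by (simp add: trig_def)

lemma continuous_on_trig [continuous_intros]: "continuous_on S (trig j)"
  unfolding trig_def[abs_def] by (intro continuous_intros)

lemma integral_trig: "integral {0..1} (trig m) = (if m = 0 then 1 else 0)"
  by (rule integral_unique) (rule trig_has_integral)

context
  fixes \<alpha> :: "int \<Rightarrow> complex" and f :: "real \<Rightarrow> complex"
  assumes trig_sum: "\<And>x. ((\<lambda>j. \<alpha> j * trig j x) has_sum f x) UNIV"
begin

lemma trig_coeffs_abs_summable: "(\<lambda>j. cmod (\<alpha> j)) summable_on UNIV"
proof -
  have "\<alpha> summable_on UNIV"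
    using trig_sum[of 0] by (auto simp: trig_def summable_on_def)
  then show ?thesis by (simp add: summable_on_iff_abs_summable_on_complex)
qed

lemma trig_series_continuous: "continuous_on S f"
proof (rule uniform_limit_theorem)
  show "uniform_limit S (\<lambda>X x. \<Sum>j\<in>X. \<alpha> j * trig j x) f (finite_subsets_at_top UNIV)"
    by (rule Weierstrass_m_test_general'[OF _ _ trig_coeffs_abs_summable])
      (use trig_sum in \<open>auto simp: norm_mult\<close>)
qed (auto intro!: continuous_intros always_eventually)

text \<open>Absolute summability makes the series converge uniformly, also after multiplication by
  the bounded function u, so it may be integrated termwise. Taking u to be \<open>trig (- k)\<close>
  gives the Fourier coefficients, and u = \<open>cnj (f x)\<close> gives Parseval's
  identity.\<close>

lemma trig_series_mult_integral:
  assumes u: "continuous_on {0..1} u"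
  shows "((\<lambda>j. \<alpha> j * integral {0..1} (\<lambda>x. trig j x * u x)) has_sum integral {0..1} (\<lambda>x. f x * u x)) UNIV"
proof -
  obtain B where B: "\<forall>x\<in>{0..1}. cmod (u x) \<le> B"
    using compact_imp_bounded[OF compact_continuous_image[OF u compact_Icc]]
    unfolding bounded_iff by auto
  have "uniform_limit {0..1} (\<lambda>X x. \<Sum>j\<in>X. \<alpha> j * (trig j x * u x)) (\<lambda>x. f x * u x)
      (finite_subsets_at_top UNIV)"
  proof (rule Weierstrass_m_test_general')
    show "((\<lambda>j. \<alpha> j * (trig j x * u x)) has_sum f x * u x) UNIV" for x
      using has_sum_cmult_left[OF trig_sum[of x], of "u x"] by (simp add: mult.assoc)
    show "(\<lambda>j. cmod (\<alpha> j) * B) summable_on UNIV"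
      by (intro summable_on_cmult_left trig_coeffs_abs_summable)
  qed (use B in \<open>auto simp: norm_mult intro!: mult_left_mono\<close>)
  then obtain I J where IJ:
    "\<And>X. ((\<lambda>x. \<Sum>j\<in>X. \<alpha> j * (trig j x * u x)) has_integral I X) {0..1}"
    "((\<lambda>x. f x * u x) has_integral J) {0..(1::real)}"
    "(I \<longlongrightarrow> J) (finite_subsets_at_top UNIV)"
    by (rule uniform_limit_integral) (auto intro!: continuous_intros u)
  have "I X = (\<Sum>j\<in>X. \<alpha> j * integral {0..1} (\<lambda>x. trig j x * u x))" if "finite X" for X
  proof -
    have "((\<lambda>x. \<Sum>j\<in>X. \<alpha> j * (trig j x * u x)) has_integral
        (\<Sum>j\<in>X. \<alpha> j * integral {0..1} (\<lambda>x. trig j x * u x))) {0..1}"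
      by (intro has_integral_sum that has_integral_mult_right integrable_integral
          integrable_continuous_real continuous_intros u)
    with IJ(1)[of X] show ?thesis by (rule has_integral_unique)
  qed
  then have "\<forall>\<^sub>F X in finite_subsets_at_top UNIV. I X = (\<Sum>j\<in>X. \<alpha> j * integral {0..1} (\<lambda>x. trig j x * u x))"
    by (auto intro: eventually_finite_subsets_at_top_weakI)
  then have "((\<lambda>X. \<Sum>j\<in>X. \<alpha> j * integral {0..1} (\<lambda>x. trig j x * u x)) \<longlongrightarrow> J) (finite_subsets_at_top UNIV)"
    using IJ(3) by (rule Lim_transform_eventually[rotated])
  with IJ(2) show ?thesis by (simp add: has_sum_def integral_unique)
qed

lemma trig_series_fourier_coeff: "integral {0..1} (\<lambda>x. f x * trig (- k) x) = \<alpha> k"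
proof -
  have "((\<lambda>j. \<alpha> j * (if j = k then 1 else 0)) has_sum integral {0..1} (\<lambda>x. f x * trig (- k) x)) UNIV"
    using trig_series_mult_integral[of "trig (- k)"]
    by (simp add: trig_mult integral_trig continuous_on_trig)
  moreover have "((\<lambda>j. \<alpha> j * (if j = k then 1 else 0)) has_sum \<alpha> k) UNIV"
    by (rule has_sum_finite_neutralI[of "{k}"]) auto
  ultimately show ?thesis by (rule has_sum_unique)
qed

lemma trig_series_parseval:
  "((\<lambda>j. (cmod (\<alpha> j))\<^sup>2) has_sum integral {0..1} (\<lambda>x. (cmod (f x))\<^sup>2)) UNIV"
proof -
  have cnj_coeff: "integral {0..1} (\<lambda>x. trig j x * cnj (f x)) = cnj (\<alpha> j)" for j
    using arg_cong[OF trig_series_fourier_coeff[of j], of cnj]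
    by (simp add: integral_cnj cnj_trig mult.commute)
  have "((\<lambda>x. (cmod (f x))\<^sup>2) has_integral integral {0..1} (\<lambda>x. (cmod (f x))\<^sup>2)) {0..1}"
    by (intro integrable_integral integrable_continuous_real continuous_intros trig_series_continuous)
  from has_integral_of_real[OF this]
  have "integral {0..1} (\<lambda>x. f x * cnj (f x)) = complex_of_real (integral {0..1} (\<lambda>x. (cmod (f x))\<^sup>2))"
    unfolding complex_norm_square[symmetric] by (rule integral_unique)
  moreover have "((\<lambda>j. \<alpha> j * cnj (\<alpha> j)) has_sum integral {0..1} (\<lambda>x. f x * cnj (f x))) UNIV"
    using trig_series_mult_integral[of "\<lambda>x. cnj (f x)"]
    by (simp add: cnj_coeff continuous_on_cnj trig_series_continuous)
  ultimately have "((\<lambda>j. complex_of_real ((cmod (\<alpha> j))\<^sup>2)) has_sum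
      complex_of_real (integral {0..1} (\<lambda>x. (cmod (f x))\<^sup>2))) UNIV"
    by (simp add: complex_norm_square del: of_real_power)
  then show ?thesis by (simp only: has_sum_of_real_iff)
qed

end

section \<open>Square-integrable functions on the unit interval\<close>

lemma continuous_lebesgue_integral_01:
  fixes g :: "real \<Rightarrow> 'b::euclidean_space"
  assumes "continuous_on {0..1} g"
  shows "integral\<^sup>L (lebesgue_on {0..1}) g = integral {0..1} g"
  by (intro lebesgue_integral_eq_integral continuous_imp_integrable_real assms) simp

lemma L2_space_continuous:
  assumes "continuous_on {0..1} g"
  shows "g \<in> L2_space"
  unfolding L2_space_def
  by (auto intro!: continuous_imp_measurable_on_sets_lebesgue continuous_imp_integrable_real
      continuous_intros assms)

lemma L2_norm_trig_series:
  assumes "\<And>x. ((\<lambda>j. \<alpha> j * trig j x) has_sum f x) UNIV"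
  shows "L2_norm f = sqrt (\<Sum>\<^sub>\<infinity>j. (cmod (\<alpha> j))\<^sup>2)"
proof -
  have "continuous_on {0..1} f"
    using assms by (rule trig_series_continuous)
  then have "L2_norm f = sqrt (integral {0..1} (\<lambda>x. (cmod (f x))\<^sup>2))"
    unfolding L2_norm_def by (subst continuous_lebesgue_integral_01) (auto intro!: continuous_intros)
  then show ?thesis using trig_series_parseval[OF assms] by (simp add: infsumI)
qed

lemma L2_space_cmult:
  assumes "g \<in> L2_space"
  shows "(\<lambda>x. c * g x) \<in> L2_space"
  using assms unfolding L2_space_def by (auto simp: norm_mult power_mult_distrib)

lemma L2_space_add:
  assumes "g \<in> L2_space" "h \<in> L2_space"
  shows "(\<lambda>x. g x + h x) \<in> L2_space"
proof -
  have *: "(cmod (g x + h x))\<^sup>2 \<le> 2 * (cmod (g x))\<^sup>2 + 2 * (cmod (h x))\<^sup>2" for x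
  proof -
    have "(cmod (g x + h x))\<^sup>2 \<le> (cmod (g x) + cmod (h x))\<^sup>2"
      by (intro power_mono norm_triangle_ineq) simp
    also have "\<dots> \<le> 2 * (cmod (g x))\<^sup>2 + 2 * (cmod (h x))\<^sup>2"
      using sum_squares_bound[of "cmod (g x)" "cmod (h x)"] by (simp add: power2_sum)
    finally show ?thesis .
  qed
  have meas: "g \<in> borel_measurable (lebesgue_on {0..1})" "h \<in> borel_measurable (lebesgue_on {0..1})"
    using assms by (auto simp: L2_space_def)
  have "integrable (lebesgue_on {0..1}) (\<lambda>x. (cmod (g x + h x))\<^sup>2)"
  proof (rule Bochner_Integration.integrable_bound)
    show "integrable (lebesgue_on {0..1}) (\<lambda>x. 2 * (cmod (g x))\<^sup>2 + 2 * (cmod (h x))\<^sup>2)"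
      using assms by (auto simp: L2_space_def)
  qed (use meas * in auto)
  then show ?thesis using meas by (auto simp: L2_space_def)
qed

lemma L2_space_sum:
  fixes n :: nat
  assumes "\<And>i. i < n \<Longrightarrow> g i \<in> L2_space"
  shows "(\<lambda>x. \<Sum>i<n. c i * g i x) \<in> L2_space"
  using assms
proof (induction n)
  case 0
  show ?case by (simp add: L2_space_def)
next
  case (Suc n)
  then show ?case by (auto intro!: L2_space_add L2_space_cmult)
qed

text \<open>This bounds a quadrature error by an L2 error. Integrability follows from t \<le> 1 +
  t^2; the inequality is the nonnegativity of the variance of \<open>cmod (u x)\<close> on a space
  of total mass one.\<close>

lemma
  assumes "u \<in> L2_space"
  shows L2_space_integrable: "integrable (lebesgue_on {0..1}) u"
    and cmod_integral_le_L2_norm: "cmod (integral\<^sup>L (lebesgue_on {0..1}) u) \<le> L2_norm u"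
proof -
  let ?M = "lebesgue_on {0..1::real}"
  have meas: "u \<in> borel_measurable ?M" and sq: "integrable ?M (\<lambda>x. (cmod (u x))\<^sup>2)"
    using assms by (auto simp: L2_space_def)
  have one: "integrable ?M (\<lambda>x. c)" "integral\<^sup>L ?M (\<lambda>x. c) = c" for c :: real
    by (simp_all add: continuous_imp_integrable_real measure_restrict_space)
  have nrm: "integrable ?M (\<lambda>x. cmod (u x))"
  proof (rule Bochner_Integration.integrable_bound)
    show "integrable ?M (\<lambda>x. 1 + (cmod (u x))\<^sup>2)"
      using one sq by simp
    have "cmod (u x) \<le> 1 + (cmod (u x))\<^sup>2" for x
      using sum_squares_bound[of 1 "cmod (u x)"] norm_ge_zero[of "u x"]
      unfolding power_one mult_1_right by linarith
    then show "AE x in ?M. norm (cmod (u x)) \<le> norm (1 + (cmod (u x))\<^sup>2)"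
      by (intro AE_I2) (simp add: abs_of_nonneg)
  qed (use meas in auto)
  then show "integrable ?M u" using meas by (rule integrable_norm_cancel)
  define m where "m = integral\<^sup>L ?M (\<lambda>x. cmod (u x))"
  have "0 \<le> integral\<^sup>L ?M (\<lambda>x. (cmod (u x) - m)\<^sup>2)" by simp
  also have "(\<lambda>x. (cmod (u x) - m)\<^sup>2) = (\<lambda>x. (cmod (u x))\<^sup>2 - 2 * m * cmod (u x) + m\<^sup>2)"
    by (auto simp: power2_diff)
  also have "integral\<^sup>L ?M \<dots> = integral\<^sup>L ?M (\<lambda>x. (cmod (u x))\<^sup>2) - 2 * m * m + m\<^sup>2"
    using sq nrm one by (simp add: m_def)
  finally have "m\<^sup>2 \<le> integral\<^sup>L ?M (\<lambda>x. (cmod (u x))\<^sup>2)"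
    by (simp add: power2_eq_square)
  then have "m \<le> L2_norm u"
    unfolding L2_norm_def by (rule real_le_rsqrt)
  moreover have "cmod (integral\<^sup>L ?M u) \<le> m"
    unfolding m_def by (rule integral_norm_bound)
  ultimately show "cmod (integral\<^sup>L ?M u) \<le> L2_norm u" by simp
qed

subsection \<open>Worst-case errors\<close>

lemma coeffs_of_finite:
  assumes J: "finite J" and supp: "\<And>j. j \<notin> J \<Longrightarrow> \<alpha> j = 0" and \<gamma>: "\<And>j. \<gamma> j = 0 \<Longrightarrow> \<alpha> j = 0"
  shows "coeffs_of \<gamma> (\<lambda>x. \<Sum>j\<in>J. \<alpha> j * trig j x) \<alpha>"
proof -
  have "(\<lambda>j. (cmod (\<alpha> j))\<^sup>2 / (\<gamma> j)\<^sup>2) summable_on ({j. \<gamma> j \<noteq> 0} \<inter> J)"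
    using J by (intro summable_on_finite) simp
  then have "(\<lambda>j. (cmod (\<alpha> j))\<^sup>2 / (\<gamma> j)\<^sup>2) summable_on {j. \<gamma> j \<noteq> 0}"
    by (rule summable_on_cong_neutral[THEN iffD1, rotated -1]) (auto simp: supp)
  moreover have "((\<lambda>j. \<alpha> j * trig j x) has_sum (\<Sum>j\<in>J. \<alpha> j * trig j x)) UNIV" for x
    by (rule has_sum_finite_neutralI[OF J]) (auto simp: supp)
  ultimately show ?thesis using \<gamma> by (simp add: coeffs_of_def)
qed

lemma H_norm_finite:
  assumes "finite J" "\<And>j. j \<notin> J \<Longrightarrow> \<alpha> j = 0" "coeffs_of \<gamma> f \<alpha>"
  shows "H_norm \<gamma> f = sqrt (\<Sum>j\<in>J. (cmod (\<alpha> j))\<^sup>2 / (\<gamma> j)\<^sup>2)"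
proof -
  have "(\<Sum>\<^sub>\<infinity>j\<in>{j. \<gamma> j \<noteq> 0}. (cmod (\<alpha> j))\<^sup>2 / (\<gamma> j)\<^sup>2) = (\<Sum>\<^sub>\<infinity>j\<in>J. (cmod (\<alpha> j))\<^sup>2 / (\<gamma> j)\<^sup>2)"
    by (rule infsum_cong_neutral) (use assms in \<open>auto simp: coeffs_of_def\<close>)
  then show ?thesis using assms by (simp add: H_norm_eq)
qed

lemma L2_norm_finite:
  assumes "finite J" "\<And>j. j \<notin> J \<Longrightarrow> \<alpha> j = 0" "coeffs_of \<gamma> f \<alpha>"
  shows "L2_norm f = sqrt (\<Sum>j\<in>J. (cmod (\<alpha> j))\<^sup>2)"
proof -
  have "L2_norm f = sqrt (\<Sum>\<^sub>\<infinity>j. (cmod (\<alpha> j))\<^sup>2)"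
    by (rule L2_norm_trig_series) (use assms in \<open>auto simp: coeffs_of_def\<close>)
  also have "(\<Sum>\<^sub>\<infinity>j. (cmod (\<alpha> j))\<^sup>2) = (\<Sum>\<^sub>\<infinity>j\<in>J. (cmod (\<alpha> j))\<^sup>2)"
    by (rule infsum_cong_neutral) (use assms in auto)
  finally show ?thesis using assms by simp
qed

lemma H_space_continuous:
  assumes "f \<in> H_space \<gamma>"
  shows "continuous_on S f"
proof -
  obtain \<alpha> where "coeffs_of \<gamma> f \<alpha>" using assms by (auto simp: H_space_def)
  then show ?thesis
    by (intro trig_series_continuous[of \<alpha>]) (auto simp: coeffs_of_def)
qed

lemma trig_sum_in_H_space:
  assumes "finite J" "\<And>j. j \<in> J \<Longrightarrow> \<gamma> j \<noteq> 0"
  shows "(\<lambda>x. \<Sum>j\<in>J. c j * trig j x) \<in> H_space \<gamma>"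
proof -
  have "coeffs_of \<gamma> (\<lambda>x. \<Sum>j\<in>J. (if j \<in> J then c j else 0) * trig j x) (\<lambda>j. if j \<in> J then c j else 0)"
    by (rule coeffs_of_finite) (use assms in auto)
  then show ?thesis by (auto simp: H_space_def cong: sum.cong)
qed

section \<open>Linear functionals on trigonometric polynomials\<close>

lemma
  assumes "linear_functional \<gamma> L" "f \<in> H_space \<gamma>"
  shows linear_functional_add: "h \<in> H_space \<gamma> \<Longrightarrow> L (\<lambda>x. f x + h x) = L f + L h"
    and linear_functional_cmult: "L (\<lambda>x. c * f x) = c * L f"
  using assms by (simp_all add: linear_functional_def)

lemma linear_functional_trig_sum:
  assumes L: "linear_functional \<gamma> L" and "finite J" "\<And>j. j \<in> J \<Longrightarrow> \<gamma> j \<noteq> 0"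
  shows "L (\<lambda>x. \<Sum>j\<in>J. c j * trig j x) = (\<Sum>j\<in>J. c j * L (trig j))"
  using assms(2,3)
proof (induction J rule: finite_induct)
  case empty
  have "(\<lambda>x. 0) \<in> H_space \<gamma>" using trig_sum_in_H_space[of "{}"] by simp
  from linear_functional_cmult[OF L this, of 0] show ?case by simp
next
  case (insert k J)
  have single: "(\<lambda>x. b * trig k x) \<in> H_space \<gamma>" for b
    using trig_sum_in_H_space[of "{k}" \<gamma> "\<lambda>_. b"] insert.prems by simp
  have "L (\<lambda>x. c k * trig k x + (\<Sum>j\<in>J. c j * trig j x))
      = L (\<lambda>x. c k * trig k x) + L (\<lambda>x. \<Sum>j\<in>J. c j * trig j x)"
    by (rule linear_functional_add[OF L single trig_sum_in_H_space]) (use insert in auto)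
  moreover have "L (\<lambda>x. c k * trig k x) = c k * L (trig k)"
    using linear_functional_cmult[OF L single[of 1], of "c k"] by simp
  ultimately show ?case using insert by simp
qed

lemma linear_functional_fourier_coeff:
  "linear_functional \<gamma> (\<lambda>f. integral {0..1} (\<lambda>x. f x * trig k x))"
  unfolding linear_functional_def
  by (auto simp: distrib_right mult.assoc intro!: integral_add integrable_continuous_real
      continuous_on_mult continuous_on_trig intro: H_space_continuous)

section \<open>Two-sided bounds for approximation numbers and duality for sampling numbers\<close>

lemma worst_case_error_ge:
  assumes "f \<in> H_space \<gamma>" "H_norm \<gamma> f \<le> 1" "e \<le> L2_norm (\<lambda>x. f x - A f x)"
  shows "ennreal e \<le> worst_case_error \<gamma> A"
  unfolding worst_case_error_def
  by (rule SUP_upper2[of f]) (use assms in \<open>auto intro: ennreal_leI\<close>)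

text \<open>On the span of the \<open>trig j\<close> with j in J, a space of dimension larger than
  n, the n functionals have a common nonzero zero f. The algorithm returns 0 at f, and on this span
  the L2 norm is at least b times the norm of the space.\<close>

lemma approximation_number_ge:
  assumes J: "finite J" "n < card J" and b: "\<And>j. j \<in> J \<Longrightarrow> b \<le> \<gamma> j"
  shows "ennreal b \<le> approximation_number \<gamma> n"
proof (cases "b > 0")
  \<comment> \<open>\<open>ennreal\<close> sends nonpositive reals to 0.\<close>
  case False
  then show ?thesis by (simp add: ennreal_neg)
next
  case True
  show ?thesis
    unfolding approximation_number_def
  proof (intro INF_greatest, clarify)
    fix L and g :: "nat \<Rightarrow> real \<Rightarrow> complex"
    assume Lg: "\<forall>i<n. linear_functional \<gamma> (L i) \<and> g i \<in> L2_space"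
    obtain x where x: "\<exists>r\<in>J. x r \<noteq> 0" "\<And>i. i < n \<Longrightarrow> (\<Sum>r\<in>J. L i (trig r) * x r) = 0"
      using ex_nonzero_annihilated[OF J, of "\<lambda>i r. L i (trig r)"] by metis
    define S where "S = (\<Sum>j\<in>J. (cmod (x j))\<^sup>2)"
    have S: "S > 0"
      unfolding S_def using J x(1) by (auto intro: sum_pos2)
    \<comment> \<open>The scaling makes the L2 norm of f equal to b, which keeps its
      \<open>H_norm\<close> at most 1.\<close>
    define \<alpha> where "\<alpha> j = (if j \<in> J then of_real (b / sqrt S) * x j else 0)" for j
    define f where "f = (\<lambda>x. \<Sum>j\<in>J. \<alpha> j * trig j x)"
    have pos: "\<gamma> j > 0" if "j \<in> J" for j using b[OF that] True by simp
    have coeffs: "coeffs_of \<gamma> f \<alpha>"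
      unfolding f_def by (rule coeffs_of_finite) (use J pos in \<open>force simp: \<alpha>_def\<close>)+
    have \<alpha>2: "(cmod (\<alpha> j))\<^sup>2 = b\<^sup>2 * ((cmod (x j))\<^sup>2 / S)" if "j \<in> J" for j
      using that S True by (simp add: \<alpha>_def norm_mult norm_divide power_mult_distrib power_divide)
    have S1: "(\<Sum>j\<in>J. (cmod (x j))\<^sup>2 / S) = 1"
      using S by (simp add: S_def flip: sum_divide_distrib)
    have "H_norm \<gamma> f = sqrt (\<Sum>j\<in>J. (cmod (\<alpha> j))\<^sup>2 / (\<gamma> j)\<^sup>2)"
      by (rule H_norm_finite[OF _ _ coeffs]) (auto simp: J \<alpha>_def)
    also have "\<dots> \<le> sqrt (\<Sum>j\<in>J. (cmod (x j))\<^sup>2 / S)"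
    proof (intro real_sqrt_le_mono sum_mono)
      fix j assume j: "j \<in> J"
      have "b\<^sup>2 \<le> (\<gamma> j)\<^sup>2" using b[OF j] True by (simp add: power_mono)
      then have "b\<^sup>2 * ((cmod (x j))\<^sup>2 / S) \<le> (\<gamma> j)\<^sup>2 * ((cmod (x j))\<^sup>2 / S)"
        using S by (intro mult_right_mono) auto
      then show "(cmod (\<alpha> j))\<^sup>2 / (\<gamma> j)\<^sup>2 \<le> (cmod (x j))\<^sup>2 / S"
        unfolding \<alpha>2[OF j] using pos[OF j]
        by (subst pos_divide_le_eq) (simp_all only: mult.commute zero_less_power)
    qed
    finally have "H_norm \<gamma> f \<le> 1" by (simp add: S1)
    moreover have "f \<in> H_space \<gamma>" using coeffs by (auto simp: H_space_def)
    moreover have "L2_norm f = b"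
    proof -
      have "L2_norm f = sqrt (\<Sum>j\<in>J. (cmod (\<alpha> j))\<^sup>2)"
        by (rule L2_norm_finite[OF _ _ coeffs]) (auto simp: J \<alpha>_def)
      also have "(\<Sum>j\<in>J. (cmod (\<alpha> j))\<^sup>2) = b\<^sup>2 * (\<Sum>j\<in>J. (cmod (x j))\<^sup>2 / S)"
        unfolding sum_distrib_left by (intro sum.cong refl \<alpha>2)
      finally show ?thesis using True by (simp add: S1)
    qed
    moreover have "L i f = 0" if "i < n" for i
    proof -
      have "L i f = (\<Sum>j\<in>J. \<alpha> j * L i (trig j))"
        unfolding f_def
        by (rule linear_functional_trig_sum) (use Lg that J pos in force)+
      also have "\<dots> = of_real (b / sqrt S) * (\<Sum>j\<in>J. L i (trig j) * x j)"
        unfolding sum_distrib_left by (intro sum.cong refl) (simp add: \<alpha>_def)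
      finally show ?thesis using x(2)[OF that] by simp
    qed
    ultimately show "ennreal b \<le> worst_case_error \<gamma> (\<lambda>f x. \<Sum>i<n. L i f * g i x)"
      by (intro worst_case_error_ge[of f]) auto
  qed
qed

text \<open>The algorithm is the partial Fourier sum over the frequencies \<open>e i\<close>. The
  error retains only frequencies where \<gamma> is bounded by b, so its L2 norm is at most b times
  the norm of f.\<close>

lemma approximation_number_le:
  assumes e: "inj_on e {..<n}" and b: "\<And>j. j \<notin> e ` {..<n} \<Longrightarrow> \<bar>\<gamma> j\<bar> \<le> b"
  shows "approximation_number \<gamma> n \<le> ennreal b"
proof -
  define L where "L i f = integral {0..1} (\<lambda>x. f x * trig (- e i) x)" for i and f :: "real \<Rightarrow> complex"
  define g where "g i = trig (e i)" for i
  have "approximation_number \<gamma> n \<le> worst_case_error \<gamma> (\<lambda>f x. \<Sum>i<n. L i f * g i x)"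
    unfolding approximation_number_def
    by (rule INF_lower2[of "(L, g)"])
      (auto simp: L_def[abs_def] g_def linear_functional_fourier_coeff
        intro!: L2_space_continuous continuous_on_trig)
  also have "\<dots> \<le> ennreal b"
    unfolding worst_case_error_def
  proof (intro SUP_least, clarify)
    fix f assume f: "f \<in> H_space \<gamma>" "H_norm \<gamma> f \<le> 1"
    then obtain \<alpha> where \<alpha>: "coeffs_of \<gamma> f \<alpha>" by (auto simp: H_space_def)
    let ?Z = "{j. \<gamma> j \<noteq> 0}"
    have \<alpha>0: "\<alpha> j = 0" if "\<gamma> j = 0" for j using \<alpha> that by (simp add: coeffs_of_def)
    have summ: "(\<lambda>j. (cmod (\<alpha> j))\<^sup>2 / (\<gamma> j)\<^sup>2) summable_on ?Z" using \<alpha> by (simp add: coeffs_of_def)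
    have hs: "((\<lambda>j. \<alpha> j * trig j x) has_sum f x) UNIV" for x using \<alpha> by (simp add: coeffs_of_def)
    have L: "L i f = \<alpha> (e i)" for i
      unfolding L_def by (rule trig_series_fourier_coeff[OF hs])
    define \<beta> where "\<beta> j = (if j \<in> e ` {..<n} then 0 else \<alpha> j)" for j
    \<comment> \<open>Finitely many frequencies are removed from infinitely many, so some j remains,
      and there b dominates an absolute value.\<close>
    have b0: "b \<ge> 0"
    proof -
      have "infinite (- e ` {..<n})" by (simp add: Compl_eq_Diff_UNIV infinite_UNIV_int)
      then obtain j where "j \<notin> e ` {..<n}" using infinite_imp_nonempty by blast
      from b[OF this] show ?thesis by linarith
    qed
    have beta_sum: "((\<lambda>j. \<beta> j * trig j x) has_sum (f x - (\<Sum>i<n. L i f * g i x))) UNIV" for x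
    proof -
      let ?h = "\<lambda>j. if j \<in> e ` {..<n} then \<alpha> j * trig j x else 0"
      have "(?h has_sum (\<Sum>j\<in>e ` {..<n}. ?h j)) UNIV"
        by (rule has_sum_finite_neutralI[of "e ` {..<n}"]) auto
      also have "(\<Sum>j\<in>e ` {..<n}. ?h j) = (\<Sum>i<n. L i f * g i x)"
        using e by (simp add: sum.reindex L g_def)
      finally have "((\<lambda>j. \<alpha> j * trig j x + - 1 * ?h j) has_sum (f x + - 1 * (\<Sum>i<n. L i f * g i x))) UNIV"
        by (intro has_sum_add has_sum_cmult_right hs)
      also have "(\<lambda>j. \<alpha> j * trig j x + - 1 * ?h j) = (\<lambda>j. \<beta> j * trig j x)"
        by (auto simp: \<beta>_def)
      finally show ?thesis by simp
    qed
    have "(\<Sum>\<^sub>\<infinity>j. (cmod (\<beta> j))\<^sup>2) \<le> (\<Sum>\<^sub>\<infinity>j\<in>?Z. b\<^sup>2 * ((cmod (\<alpha> j))\<^sup>2 / (\<gamma> j)\<^sup>2))"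
    proof (rule infsum_mono_neutral)
      show "(\<lambda>j. (cmod (\<beta> j))\<^sup>2) summable_on UNIV"
        using trig_series_parseval[OF beta_sum] by (auto simp: summable_on_def)
      show "(\<lambda>j. b\<^sup>2 * ((cmod (\<alpha> j))\<^sup>2 / (\<gamma> j)\<^sup>2)) summable_on ?Z"
        using summ by (rule summable_on_cmult_right)
      show "(cmod (\<beta> j))\<^sup>2 \<le> b\<^sup>2 * ((cmod (\<alpha> j))\<^sup>2 / (\<gamma> j)\<^sup>2)" if "j \<in> UNIV \<inter> ?Z" for j
      proof (cases "j \<in> e ` {..<n}")
        case True
        then show ?thesis by (simp add: \<beta>_def)
      next
        case False
        then have "(\<gamma> j)\<^sup>2 \<le> b\<^sup>2" using b b0 by (simp add: abs_le_square_iff[symmetric])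
        then have "(cmod (\<alpha> j))\<^sup>2 * (\<gamma> j)\<^sup>2 \<le> (cmod (\<alpha> j))\<^sup>2 * b\<^sup>2"
          by (rule mult_left_mono) simp
        then show ?thesis using False that by (simp add: \<beta>_def le_divide_eq mult.commute)
      qed
    qed (auto simp: \<beta>_def \<alpha>0)
    also have "\<dots> = b\<^sup>2 * (\<Sum>\<^sub>\<infinity>j\<in>?Z. (cmod (\<alpha> j))\<^sup>2 / (\<gamma> j)\<^sup>2)"
      by (rule infsum_cmult_right) (rule summ)
    also have "\<dots> \<le> b\<^sup>2 * 1"
      using f(2) by (intro mult_left_mono) (simp_all add: H_norm_eq[OF \<alpha>])
    finally have "sqrt (\<Sum>\<^sub>\<infinity>j. (cmod (\<beta> j))\<^sup>2) \<le> b"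
      using b0 by (simp add: real_le_lsqrt)
    then show "ennreal (L2_norm (\<lambda>x. f x - (\<Sum>i<n. L i f * g i x))) \<le> ennreal b"
      by (simp add: L2_norm_trig_series[OF beta_sum] ennreal_leI)
  qed
  finally show ?thesis .
qed

text \<open>Point evaluations are linear functionals, so every sampling algorithm also competes in
  the infimum for the approximation number.\<close>

lemma approximation_number_le_sampling_number:
  "approximation_number \<gamma> n \<le> sampling_number \<gamma> n"
  unfolding sampling_number_def
proof (intro INF_greatest, clarify)
  fix t :: "nat \<Rightarrow> real" and g :: "nat \<Rightarrow> real \<Rightarrow> complex"
  assume "\<forall>i<n. t i \<in> {0..1} \<and> g i \<in> L2_space"
  then show "approximation_number \<gamma> n \<le> worst_case_error \<gamma> (\<lambda>f x. \<Sum>i<n. f (t i) * g i x)"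
    unfolding approximation_number_def
    by (intro INF_lower2[of "(\<lambda>i f. f (t i), g)"]) (auto simp: linear_functional_def)
qed

text \<open>Duality for quadrature: \<open>d j\<close> is the error at \<open>trig j\<close> of the
  rule with weights \<open>c i\<close>, and E is the squared norm of the error functional on the
  space with spectrum \<mu>. Nodes and weights are arbitrary in the hypothesis on e because the
  algorithm determines them.\<close>

lemma sampling_number_ge:
  assumes J: "finite J" "0 \<in> J" and lam: "\<And>j. j \<in> J \<Longrightarrow> 0 \<le> \<mu> j \<and> \<mu> j \<le> (\<gamma> j)\<^sup>2"
    and e: "\<And>t c. e \<le> (\<Sum>j\<in>J. \<mu> j * (cmod (of_bool (j = 0) - (\<Sum>i<n. c i * trig j (t i))))\<^sup>2)"
  shows "ennreal (sqrt e) \<le> sampling_number \<gamma> n"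
proof (cases "e > 0")
  case False
  then show ?thesis by (simp add: ennreal_neg)
next
  case True
  show ?thesis
    unfolding sampling_number_def
  proof (intro INF_greatest, clarify)
    fix t :: "nat \<Rightarrow> real" and g :: "nat \<Rightarrow> real \<Rightarrow> complex"
    assume tg: "\<forall>i<n. t i \<in> {0..1} \<and> g i \<in> L2_space"
    let ?M = "lebesgue_on {0..1::real}"
    define c where "c i = integral\<^sup>L ?M (g i)" for i
    define d where "d j = of_bool (j = 0) - (\<Sum>i<n. c i * trig j (t i))" for j
    define E where "E = (\<Sum>j\<in>J. \<mu> j * (cmod (d j))\<^sup>2)"
    have eE: "e \<le> E" unfolding E_def d_def by (rule e)
    then have E: "E > 0" using True by simp
    \<comment> \<open>The coefficients of the Riesz representer of the error functional, divided by
      its norm \<open>sqrt E\<close>; the quadrature error at f is then exactly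
      \<open>sqrt E\<close>.\<close>
    define \<alpha> where "\<alpha> j = (if j \<in> J then of_real (\<mu> j / sqrt E) * cnj (d j) else 0)" for j
    define f where "f = (\<lambda>x. \<Sum>j\<in>J. \<alpha> j * trig j x)"
    have lam0: "\<mu> j = 0" if "j \<in> J" "\<gamma> j = 0" for j using lam[OF that(1)] that(2) by simp
    have coeffs: "coeffs_of \<gamma> f \<alpha>"
      unfolding f_def by (rule coeffs_of_finite) (auto simp: J \<alpha>_def lam0)
    have "H_norm \<gamma> f = sqrt (\<Sum>j\<in>J. (cmod (\<alpha> j))\<^sup>2 / (\<gamma> j)\<^sup>2)"
      by (rule H_norm_finite[OF _ _ coeffs]) (auto simp: J \<alpha>_def)
    also have "\<dots> \<le> sqrt (\<Sum>j\<in>J. \<mu> j * (cmod (d j))\<^sup>2 / E)"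
    \<comment> \<open>The squared coefficient contains \<mu> twice; one factor is absorbed by the
      square of \<gamma>, which dominates it.\<close>
    proof (intro real_sqrt_le_mono sum_mono)
      fix j assume j: "j \<in> J"
      have \<alpha>2: "(cmod (\<alpha> j))\<^sup>2 = \<mu> j * (\<mu> j * (cmod (d j))\<^sup>2 / E)"
        using j E by (simp add: \<alpha>_def norm_mult norm_divide power_mult_distrib power_divide) 
          (simp add: power2_eq_square)
      show "(cmod (\<alpha> j))\<^sup>2 / (\<gamma> j)\<^sup>2 \<le> \<mu> j * (cmod (d j))\<^sup>2 / E"
      proof (cases "\<gamma> j = 0")
        case True
        then show ?thesis using j lam0 by simp
      next
        case False
        have "\<mu> j * (\<mu> j * (cmod (d j))\<^sup>2 / E) \<le> (\<gamma> j)\<^sup>2 * (\<mu> j * (cmod (d j))\<^sup>2 / E)"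
          using lam[OF j] E by (intro mult_right_mono) auto
        then show ?thesis unfolding \<alpha>2 using False
          by (subst pos_divide_le_eq) (simp_all only: mult.commute zero_less_power2 simp_thms)
      qed
    qed
    also have "\<dots> = 1" using E by (simp add: E_def flip: sum_divide_distrib)
    finally have norm: "H_norm \<gamma> f \<le> 1" .
    have Hf: "f \<in> H_space \<gamma>" using coeffs by (auto simp: H_space_def)
    define u where "u = (\<lambda>x. f x - (\<Sum>i<n. f (t i) * g i x))"
    have fL2: "f \<in> L2_space" by (intro L2_space_continuous H_space_continuous[OF Hf])
    have SL2: "(\<lambda>x. \<Sum>i<n. f (t i) * g i x) \<in> L2_space" by (rule L2_space_sum) (use tg in simp)
    have uL2: "u \<in> L2_space"
      using L2_space_add[OF fL2 L2_space_cmult[OF SL2, of "-1"]] by (simp add: u_def)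
    have "integral\<^sup>L ?M f = integral {0..1} (\<lambda>x. f x * trig (- 0) x)"
      by (simp add: continuous_lebesgue_integral_01 H_space_continuous[OF Hf])
    also have "\<dots> = \<alpha> 0"
      by (rule trig_series_fourier_coeff) (use coeffs in \<open>simp add: coeffs_of_def\<close>)
    \<comment> \<open>Written as a sum over J, the integral can be subtracted termwise from the
      quadrature value; this uses that 0 lies in J.\<close>
    also have "\<dots> = (\<Sum>j\<in>J. \<alpha> j * of_bool (j = 0))"
      using J by (simp add: of_bool_def if_distrib cong: if_cong)
    finally have int_f: "integral\<^sup>L ?M f = (\<Sum>j\<in>J. \<alpha> j * of_bool (j = 0))" .
    have "integral\<^sup>L ?M (\<lambda>x. \<Sum>i<n. f (t i) * g i x) = (\<Sum>i<n. f (t i) * c i)"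
      unfolding c_def
      by (subst Bochner_Integration.integral_sum) (use tg L2_space_integrable in auto)
    also have "\<dots> = (\<Sum>j\<in>J. \<alpha> j * (\<Sum>i<n. c i * trig j (t i)))"
      unfolding f_def sum_distrib_left sum_distrib_right
      by (subst sum.swap) (simp add: ac_simps)
    finally have "integral\<^sup>L ?M u = (\<Sum>j\<in>J. \<alpha> j * of_bool (j = 0)) - (\<Sum>j\<in>J. \<alpha> j * (\<Sum>i<n. c i * trig j (t i)))"
      unfolding u_def using fL2 SL2 by (simp add: L2_space_integrable int_f)
    also have "\<dots> = (\<Sum>j\<in>J. \<alpha> j * d j)"
      unfolding d_def right_diff_distrib by (rule sum_subtractf[symmetric])
    also have "\<dots> = (\<Sum>j\<in>J. of_real (\<mu> j * (cmod (d j))\<^sup>2 / sqrt E))"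
    proof (intro sum.cong refl)
      fix j assume "j \<in> J"
      then have "\<alpha> j * d j = of_real (\<mu> j / sqrt E) * (d j * cnj (d j))"
        by (simp add: \<alpha>_def)
      then show "\<alpha> j * d j = of_real (\<mu> j * (cmod (d j))\<^sup>2 / sqrt E)"
        by (simp flip: complex_norm_square)
    qed
    also have "\<dots> = of_real (sqrt E)"
      unfolding of_real_sum[symmetric] sum_divide_distrib[symmetric] E_def[symmetric]
      using E by (simp add: real_div_sqrt)
    finally have "sqrt E \<le> L2_norm u"
      using cmod_integral_le_L2_norm[OF uL2] E by simp
    then have "sqrt e \<le> L2_norm u" using eE by (meson order_trans real_sqrt_le_mono)
    then show "ennreal (sqrt e) \<le> worst_case_error \<gamma> (\<lambda>f x. \<Sum>i<n. f (t i) * g i x)"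
      unfolding u_def by (intro worst_case_error_ge[OF Hf norm])
  qed
qed

subsection \<open>Fejer kernels\<close>

text \<open>The coefficients of the Fejer kernel of order \<open>N\<close>, i.e. the triangle function
  \<open>max 0 (1 - \<bar>j\<bar> / N)\<close>.\<close>

definition fejer :: "nat \<Rightarrow> int \<Rightarrow> real" where
  "fejer N j = real (card {(r, s). r < N \<and> s < N \<and> int r - int s = j}) / real N"

lemma finite_less_pairs: "finite {(r, s). r < N \<and> s < N \<and> int r - int s = j}"
  by (rule finite_subset[of _ "{..<N} \<times> {..<N}"]) auto

lemma fejer_nonneg: "0 \<le> fejer N j"
  by (simp add: fejer_def)

lemma fejer_le_1: "fejer N j \<le> 1"
proof (cases "N = 0")
  case False
  have "card {(r, s). r < N \<and> s < N \<and> int r - int s = j} \<le> card {..<N}"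
    by (rule card_inj_on_le[where f = fst]) (auto simp: inj_on_def)
  with False show ?thesis by (simp add: fejer_def)
qed (simp add: fejer_def)

lemma fejer_eq_0:
  assumes "int N \<le> \<bar>j\<bar>"
  shows "fejer N j = 0"
proof -
  have "{(r, s). r < N \<and> s < N \<and> int r - int s = j} = {}" using assms by auto
  then show ?thesis by (simp only: fejer_def) simp
qed

lemma fejer_0:
  assumes "N > 0"
  shows "fejer N 0 = 1"
proof -
  have "{(r, s). r < N \<and> s < N \<and> int r - int s = 0} = (\<lambda>r. (r, r)) ` {..<N}" by auto
  then show ?thesis using assms by (simp add: fejer_def card_image inj_on_def)
qed

text \<open>Grouping the pairs (r, s) by their difference turns a Fejer-weighted sum into a sum over
  the entries of a Toeplitz matrix. J may exceed the support, so that one index set serves all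
  kernels of a mixture.\<close>

lemma sum_fejer_mult:
  fixes h :: "int \<Rightarrow> real"
  assumes "finite J" "{- int N<..<int N} \<subseteq> J"
  shows "(\<Sum>j\<in>J. fejer N j * h j) = (\<Sum>r<N. \<Sum>s<N. h (int r - int s)) / real N"
proof -
  have "(\<Sum>r<N. \<Sum>s<N. h (int r - int s)) = (\<Sum>(r, s)\<in>{..<N} \<times> {..<N}. h (int r - int s))"
    by (rule sum.cartesian_product)
  also have "\<dots> = (\<Sum>j\<in>J. \<Sum>p\<in>{p \<in> {..<N} \<times> {..<N}. int (fst p) - int (snd p) = j}. h (int (fst p) - int (snd p)))"
    by (subst sum.group) (use assms in \<open>auto simp: case_prod_unfold\<close>)
  also have "\<dots> = (\<Sum>j\<in>J. real N * (fejer N j * h j))"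
  proof (intro sum.cong refl)
    fix j
    have "(\<Sum>p\<in>{p \<in> {..<N} \<times> {..<N}. int (fst p) - int (snd p) = j}. h (int (fst p) - int (snd p)))
        = (\<Sum>p\<in>{(r, s). r < N \<and> s < N \<and> int r - int s = j}. h j)"
      by (rule sum.cong) auto
    then show "(\<Sum>p\<in>{p \<in> {..<N} \<times> {..<N}. int (fst p) - int (snd p) = j}. h (int (fst p) - int (snd p)))
        = real N * (fejer N j * h j)"
      by (cases "N = 0") (simp_all add: fejer_def)
  qed
  also have "\<dots> = real N * (\<Sum>j\<in>J. fejer N j * h j)"
    by (rule sum_distrib_left[symmetric])
  finally show ?thesis
    by (cases "N = 0") (simp_all add: fejer_def[of 0])
qed

text \<open>Splitting \<open>trig (r - s)\<close> into a factor for r and a factor for s writes the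
  Toeplitz matrix \<open>P (r - s)\<close> as a sum of n matrices of rank at most one. Its trace is
  \<open>N * P 0\<close>, and its squared Frobenius norm is N times the right-hand side.\<close>

lemma fejer_quadratic_form_ge:
  assumes J: "finite J" "{- int N<..<int N} \<subseteq> J" and n: "n > 0"
    and P_def: "\<And>j. P j = (\<Sum>i<n. c i * trig j (t i))"
  shows "real N / real n * (cmod (P 0))\<^sup>2 \<le> (\<Sum>j\<in>J. fejer N j * (cmod (P j))\<^sup>2)"
proof (cases "N = 0")
  case True
  then show ?thesis by (simp add: fejer_def)
next
  case False
  have P_diff: "P (int r - int s) = (\<Sum>i<n. c i * trig (int r) (t i) * trig (- int s) (t i))" for r s
    by (simp add: P_def trig_mult mult.assoc)
  have "(\<Sum>r<N. \<Sum>i<n. c i * trig (int r) (t i) * trig (- int r) (t i)) = (\<Sum>r<N. P (int r - int r))"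
    by (simp only: P_diff)
  then have trace: "(\<Sum>r<N. \<Sum>i<n. c i * trig (int r) (t i) * trig (- int r) (t i)) = of_nat N * P 0"
    by simp
  have "(real N)\<^sup>2 * (cmod (P 0))\<^sup>2 = (cmod (of_nat N * P 0))\<^sup>2"
    by (simp add: norm_mult power_mult_distrib)
  also have "\<dots> \<le> real n * (\<Sum>r<N. \<Sum>s<N. (cmod (P (int r - int s)))\<^sup>2)"
    using rank_trace_inequality[of "{..<N}" "\<lambda>i r. c i * trig (int r) (t i)" "\<lambda>i r. trig (- int r) (t i)" n]
    by (simp only: trace P_diff finite_lessThan simp_thms)
  finally show ?thesis
    unfolding sum_fejer_mult[OF J] using False n by (simp add: field_simps power2_eq_square)
qed

text \<open>Since the Fejer coefficients of order N sum to N and equal 1 at 0, K is the total mass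
  of the mixture and c is its value at 0.\<close>

lemma sampling_number_ge_fejer_mixture:
  fixes N :: "'m \<Rightarrow> nat"
  assumes I: "finite I" and w: "\<And>m. m \<in> I \<Longrightarrow> 0 \<le> w m" and N: "\<And>m. m \<in> I \<Longrightarrow> 0 < N m"
    and \<gamma>: "\<And>j. (\<Sum>m\<in>I. w m * fejer (N m) j) \<le> (\<gamma> j)\<^sup>2"
    and n: "n > 0" and c: "c = (\<Sum>m\<in>I. w m)" and K: "K = (\<Sum>m\<in>I. w m * real (N m))" "K > 0"
  shows "ennreal (sqrt (c - c\<^sup>2 * real n / K)) \<le> sampling_number \<gamma> n"
proof -
  define \<mu> where "\<mu> j = (\<Sum>m\<in>I. w m * fejer (N m) j)" for j
  define J where "J = insert 0 (\<Union>m\<in>I. {- int (N m)<..<int (N m)})"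
  have J: "finite J" "0 \<in> J" "\<And>m. m \<in> I \<Longrightarrow> {- int (N m)<..<int (N m)} \<subseteq> J"
    using I by (auto simp: J_def)
  have \<mu>0: "\<mu> 0 = c"
    unfolding \<mu>_def c by (intro sum.cong refl) (simp add: fejer_0 N)
  show ?thesis
  proof (rule sampling_number_ge[of J \<mu>])
    show "0 \<le> \<mu> j \<and> \<mu> j \<le> (\<gamma> j)\<^sup>2" for j
      using \<gamma> w by (auto simp: \<mu>_def fejer_nonneg intro!: sum_nonneg)
    fix t :: "nat \<Rightarrow> real" and b :: "nat \<Rightarrow> complex"
    define P where "P j = (\<Sum>i<n. b i * trig j (t i))" for j
    define p where "p = cmod (P 0)"
    have "K / real n * p\<^sup>2 = (\<Sum>m\<in>I. w m * (real (N m) / real n * p\<^sup>2))"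
      by (simp add: K sum_distrib_right sum_divide_distrib mult.assoc)
    also have "\<dots> \<le> (\<Sum>m\<in>I. w m * (\<Sum>j\<in>J. fejer (N m) j * (cmod (P j))\<^sup>2))"
      unfolding p_def
      by (intro sum_mono mult_left_mono fejer_quadratic_form_ge[OF J(1) J(3) n P_def] w)
    also have "\<dots> = (\<Sum>j\<in>J. \<mu> j * (cmod (P j))\<^sup>2)"
      unfolding \<mu>_def sum_distrib_left sum_distrib_right
      by (subst sum.swap) (simp add: mult.assoc)
    finally have quad: "K / real n * p\<^sup>2 \<le> (\<Sum>j\<in>J. \<mu> j * (cmod (P j))\<^sup>2)" .
    have "c * (cmod (1 - P 0))\<^sup>2 = c - 2 * c * Re (P 0) + c * (cmod (P 0))\<^sup>2"
      by (simp add: cmod_power2 power2_diff algebra_simps)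
    moreover have "(\<Sum>j\<in>J. \<mu> j * (cmod (of_bool (j = 0) - P j))\<^sup>2)
        = \<mu> 0 * (cmod (1 - P 0))\<^sup>2 + (\<Sum>j\<in>J - {0}. \<mu> j * (cmod (P j))\<^sup>2)"
      using J(1,2) by (subst sum.remove[of J 0]) auto
    moreover have "(\<Sum>j\<in>J. \<mu> j * (cmod (P j))\<^sup>2)
        = \<mu> 0 * (cmod (P 0))\<^sup>2 + (\<Sum>j\<in>J - {0}. \<mu> j * (cmod (P j))\<^sup>2)"
      using J(1,2) by (rule sum.remove)
    \<comment> \<open>Away from j = 0 both sums have the same terms; at j = 0 the expanded square
      leaves only the constant and the cross term.\<close>
    ultimately have eq: "(\<Sum>j\<in>J. \<mu> j * (cmod (of_bool (j = 0) - P j))\<^sup>2)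
        = c - 2 * c * Re (P 0) + (\<Sum>j\<in>J. \<mu> j * (cmod (P j))\<^sup>2)"
      by (simp add: \<mu>0)
    have "c \<ge> 0" using w by (auto simp: c intro: sum_nonneg)
    then have "c * Re (P 0) \<le> c * p"
      unfolding p_def by (intro mult_left_mono complex_Re_le_cmod)
    \<comment> \<open>Completing the square: as a quadratic in p the lower bound is smallest at
      \<open>p = c * n / K\<close>.\<close>
    moreover have "0 \<le> K / real n * (p - c * real n / K)\<^sup>2"
      using K(2) by simp
    moreover have "K / real n * (p - c * real n / K)\<^sup>2 = K / real n * p\<^sup>2 - 2 * (c * p) + c\<^sup>2 * real n / K"
      using K(2) n by (simp add: field_simps power2_eq_square)
    ultimately have "c - c\<^sup>2 * real n / K \<le> c - 2 * c * Re (P 0) + (\<Sum>j\<in>J. \<mu> j * (cmod (P j))\<^sup>2)"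
      using quad by linarith
    then show "c - c\<^sup>2 * real n / K \<le> (\<Sum>j\<in>J. \<mu> j * (cmod (of_bool (j = 0) - (\<Sum>i<n. b i * trig j (t i))))\<^sup>2)"
      using eq by (simp add: P_def)
  qed (use J in auto)
qed

subsection \<open>The zigzag rearrangement\<close>

text \<open>Enumerates the frequencies as 0, -1, 1, -2, 2, ..., the order in which \<gamma> takes
  the values of a.\<close>

definition zigzag :: "nat \<Rightarrow> int" where
  "zigzag i = (if even i then int (i div 2) else - int (Suc (i div 2)))"

lemma inj_zigzag: "inj zigzag"
proof (rule injI)
  fix i k assume "zigzag i = zigzag k"
  then show "i = k"
    by (cases "even i"; cases "even k") (auto simp: zigzag_def elim!: evenE oddE)
qed

lemma surj_zigzag: "surj zigzag"
proof (rule surjI)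
  fix j :: int
  show "zigzag (if j \<ge> 0 then nat (2 * j) else nat (- 2 * j - 1)) = j"
  proof (cases "j \<ge> 0")
    case True
    then obtain k where "j = int k" using nonneg_int_cases by blast
    then show ?thesis by (simp add: zigzag_def nat_mult_distrib)
  next
    case False
    then obtain k where "j = - int (Suc k)" by (metis int_cases linorder_not_le of_nat_0_le_iff)
    moreover have "nat (- 2 * - int (Suc k) - 1) = Suc (2 * k)" by simp
    ultimately show ?thesis using False by (simp only: if_False) (simp add: zigzag_def)
  qed
qed

text \<open>With this, the Fejer triangle of order \<open>Suc (m div 2)\<close> vanishes at every
  frequency of index above m, so it is supported in the level set formed by the first m + 1
  frequencies.\<close>

lemma abs_zigzag_ge:
  assumes "m < i"
  shows "int (Suc (m div 2)) \<le> \<bar>zigzag i\<bar>"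
  using assms by (auto simp: zigzag_def elim!: evenE oddE)

text \<open>Abel summation: the mass of b is recovered from its level sets, the m-th having m + 1
  elements and height \<open>b m - b (Suc m)\<close>.\<close>

lemma sum_Suc_diff_mult:
  fixes b :: "nat \<Rightarrow> real"
  shows "(\<Sum>m<M. (b m - b (Suc m)) * real (Suc m)) = (\<Sum>k<M. b k) - real M * b M"
  by (induction M) (simp_all add: algebra_simps)

context
  fixes a :: "nat \<Rightarrow> real" and \<gamma> :: "int \<Rightarrow> real"
  assumes nonneg: "\<And>n. 0 \<le> a n" and dec: "decseq a" and zz: "\<And>i. \<gamma> (zigzag i) = a i"
begin

text \<open>The upper bound removes the first n frequencies, beyond which \<gamma> is at most
  \<open>a n\<close>; the lower bound uses the first n + 1 frequencies, where \<gamma> is at least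
  \<open>a n\<close>.\<close>

lemma approximation_number_rearrangement: "approximation_number \<gamma> n = ennreal (a n)"
proof (rule antisym)
  show "approximation_number \<gamma> n \<le> ennreal (a n)"
  proof (rule approximation_number_le)
    show "inj_on zigzag {..<n}" using inj_zigzag by (rule inj_on_subset) simp
    fix j assume j: "j \<notin> zigzag ` {..<n}"
    obtain i where i: "j = zigzag i" using surj_zigzag by blast
    with j have "n \<le> i" by (meson imageI lessThan_iff not_le)
    then show "\<bar>\<gamma> j\<bar> \<le> a n" using nonneg decseqD[OF dec] by (simp add: i zz)
  qed
  show "ennreal (a n) \<le> approximation_number \<gamma> n"
  proof (rule approximation_number_ge)
    show "n < card (zigzag ` {..n})"
      using inj_on_subset[OF inj_zigzag] by (simp add: card_image)
    show "a n \<le> \<gamma> j" if "j \<in> zigzag ` {..n}" for j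
      using that decseqD[OF dec] by (auto simp: zz)
  qed simp
qed

text \<open>The spectrum is capped at the level \<open>c\<close> and cut at \<open>M\<close>; each level set of the result
  contains a Fejer triangle of at least half its size.\<close>

lemma sampling_number_ge_capped:
  assumes n: "n > 0" and T: "T = (\<Sum>k=n..<M. (a k)\<^sup>2)" "T > 0"
    and c: "c = T / (4 * real n)" "c \<le> (a 0)\<^sup>2" "(a n)\<^sup>2 \<le> c"
  shows "ennreal (sqrt (T / (8 * real n))) \<le> sampling_number \<gamma> n"
proof -
  define b where "b k = (if k < M then min ((a k)\<^sup>2) c else 0)" for k
  \<comment> \<open>Layer heights: the cut at M makes b vanish there, so \<open>b i\<close> is the
    sum of the \<open>w m\<close> with i \<le> m < M.\<close>
  define w where "w m = b m - b (Suc m)" for m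
  define K where "K = (\<Sum>m<M. w m * real (Suc (m div 2)))"
  have c_pos: "c > 0" using c(1) T(2) n by simp
  have sq_dec: "(a k)\<^sup>2 \<le> (a m)\<^sup>2" if "m \<le> k" for m k
    using decseqD[OF dec that] nonneg by (simp add: power_mono)
  have w: "w m \<ge> 0" for m
    using sq_dec[of m "Suc m"] c_pos by (auto simp: w_def b_def min_le_iff_disj)
  have M: "n < M" using T by (cases "n < M") auto
  have sum_w: "(\<Sum>m\<in>{k..<M}. w m) = b k" if "k \<le> M" for k
  proof -
    have "(\<Sum>m\<in>{k..<M}. w m) = - (\<Sum>m\<in>{k..<M}. b (Suc m) - b m)"
      by (simp add: w_def flip: sum_negf)
    also have "\<dots> = b k - b M" using sum_Suc_diff'[OF that, of b] by simp
    finally show ?thesis by (simp add: b_def)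
  qed
  have b0: "b 0 = c" using M c(2) by (simp add: b_def)
  have "T \<le> (\<Sum>k<M. b k)"
  proof -
    \<comment> \<open>From index n on the cap is inactive, because the squares do not exceed
      \<open>(a n)^2\<close>, which is at most c.\<close>
    have "T = (\<Sum>k=n..<M. b k)"
      unfolding T by (intro sum.cong refl) (use sq_dec c(3) in \<open>force simp: b_def min_def\<close>)
    also have "\<dots> \<le> (\<Sum>k<M. b k)"
      using c_pos by (intro sum_mono2) (auto simp: b_def)
    finally show ?thesis .
  qed
  also have "\<dots> = (\<Sum>m<M. w m * real (Suc m))"
    unfolding w_def sum_Suc_diff_mult by (simp add: b_def)
  also have "\<dots> \<le> (\<Sum>m<M. w m * (2 * real (Suc (m div 2))))"
  proof (intro sum_mono mult_left_mono w)
    fix m :: nat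
    have "Suc m \<le> 2 * Suc (m div 2)" by presburger
    then show "real (Suc m) \<le> 2 * real (Suc (m div 2))" by linarith
  qed
  also have "\<dots> = 2 * K" by (simp add: K_def sum_distrib_left algebra_simps)
  finally have TK: "T \<le> 2 * K" .
  then have K: "K > 0" using T(2) by simp
  \<comment> \<open>With K at least T / 2 and c = T / (4n), the subtracted term is at most c / 2.
    The remaining c / 2 is T / (8n), the source of the constant 8.\<close>
  have "c\<^sup>2 * real n / K \<le> c\<^sup>2 * real n / (T / 2)"
    using TK T(2) K by (intro divide_left_mono) auto
  also have "\<dots> = c / 2" using T(2) n by (simp add: c(1) power2_eq_square)
  finally have "T / (8 * real n) \<le> c - c\<^sup>2 * real n / K"
    by (simp add: c(1))
  then have "ennreal (sqrt (T / (8 * real n))) \<le> ennreal (sqrt (c - c\<^sup>2 * real n / K))"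
    by (intro ennreal_leI real_sqrt_le_mono)
  also have "\<dots> \<le> sampling_number \<gamma> n"
  proof (rule sampling_number_ge_fejer_mixture[where N = "\<lambda>m. Suc (m div 2)" and I = "{..<M}" and w = w])
    fix j
    obtain i where i: "j = zigzag i" using surj_zigzag by blast
    \<comment> \<open>At \<open>zigzag i\<close> the triangles with m < i vanish and the others are
      at most 1, so the mixture is dominated by the layer sum \<open>b i\<close>.\<close>
    have "(\<Sum>m<M. w m * fejer (Suc (m div 2)) j) \<le> (\<Sum>m<M. if m < i then 0 else w m)"
    proof (rule sum_mono)
      fix m
      show "w m * fejer (Suc (m div 2)) j \<le> (if m < i then 0 else w m)"
        using w[of m] fejer_le_1 abs_zigzag_ge[of m i]
        by (simp add: i fejer_eq_0 mult_left_le)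
    qed
    also have "\<dots> = (\<Sum>m\<in>{i..<M}. w m)"
      by (rule sum.mono_neutral_cong_right) auto
    also have "\<dots> \<le> b i"
      by (cases "i \<le> M") (simp_all add: sum_w b_def)
    also have "\<dots> \<le> (\<gamma> j)\<^sup>2" by (simp add: i zz b_def)
    finally show "(\<Sum>m<M. w m * fejer (Suc (m div 2)) j) \<le> (\<gamma> j)\<^sup>2" .
  next
    show "c = (\<Sum>m<M. w m)" using sum_w[of 0] b0 by (simp add: atLeast0LessThan)
  qed (use w n K in \<open>auto simp: K_def\<close>)
  finally show ?thesis .
qed

text \<open>The hypothesis on T says that the cap T / (4n) is at most \<open>(a 0)^2\<close>, so the
  capped spectrum attains it at frequency 0. If \<open>(a n)^2\<close> exceeds the cap, the
  approximation number already gives the bound; T = 0 is trivial.\<close>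

lemma sampling_number_power2_ge_partial_sum:
  assumes n: "n > 0" and T: "T = (\<Sum>k=n..<M. (a k)\<^sup>2)" and le: "T \<le> 4 * real n * (a 0)\<^sup>2"
  shows "ennreal (T / (8 * real n)) \<le> (sampling_number \<gamma> n)\<^sup>2"
proof -
  have T0: "T \<ge> 0" by (simp add: T sum_nonneg)
  have "ennreal (sqrt (T / (8 * real n))) \<le> sampling_number \<gamma> n"
  proof (cases "T > 0 \<and> (a n)\<^sup>2 \<le> T / (4 * real n)")
    case True
    show ?thesis
      by (rule sampling_number_ge_capped[OF n T _ refl]) (use True le n in \<open>auto simp: field_simps\<close>)
  next
    case False
    have "T / (8 * real n) \<le> (a n)\<^sup>2"
    proof (cases "T > 0")
      case True
      have "T / (8 * real n) \<le> T / (4 * real n)" using T0 n by (intro divide_left_mono) auto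
      then show ?thesis using False True by linarith
    qed (use T0 in simp)
    then have "sqrt (T / (8 * real n)) \<le> a n" by (rule real_le_lsqrt[OF nonneg])
    then have "ennreal (sqrt (T / (8 * real n))) \<le> approximation_number \<gamma> n"
      by (simp add: approximation_number_rearrangement ennreal_leI)
    then show ?thesis using approximation_number_le_sampling_number by (rule order_trans)
  qed
  then have "(ennreal (sqrt (T / (8 * real n))))\<^sup>2 \<le> (sampling_number \<gamma> n)\<^sup>2"
    by (rule power_mono) simp
  then show ?thesis using T0 by (simp add: ennreal_power)
qed

end

section \<open>From partial sums to the full tail\<close>

theorem theorem2:
  fixes a :: "nat \<Rightarrow> real" and \<gamma> :: "int \<Rightarrow> real"
  assumes "\<And>n. 0 \<le> a n"
    and "decseq a"
    and "summable (\<lambda>n. (a n)\<^sup>2)"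
    and "\<And>k::nat. \<gamma> (int k) = a (2 * k)"
    and "\<And>k::nat. k \<ge> 1 \<Longrightarrow> \<gamma> (- int k) = a (2 * k - 1)"
  shows "(\<forall>n. approximation_number \<gamma> n = ennreal (a n)) \<and>
    infinite {n::nat. n \<ge> 1 \<and>
      (sampling_number \<gamma> n)\<^sup>2 \<ge>
        ennreal (1 / (8 * real n)) * (\<Sum>\<^sub>\<infinity>k\<in>{n..}. (approximation_number \<gamma> k)\<^sup>2)}"
proof -
  have zz: "\<gamma> (zigzag i) = a i" for i
    using assms(4)[of "i div 2"] assms(5)[of "Suc (i div 2)"]
    by (cases "even i") (auto simp: zigzag_def elim!: evenE oddE)
  note approx = approximation_number_rearrangement[OF assms(1,2) zz]
  define T where "T = (\<Sum>k. (a k)\<^sup>2)"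
  have partial_le: "(\<Sum>k\<in>F. (a k)\<^sup>2) \<le> T" if "finite F" for F
    unfolding T_def using assms(3) that by (rule sum_le_suminf) simp
  \<comment> \<open>From n0 on, the cap built from any partial tail sum stays below
    \<open>(a 0)^2\<close>. If \<open>a 0 = 0\<close>, monotonicity makes the whole sequence vanish,
    and T = 0.\<close>
  have "\<exists>n0. T \<le> 4 * real n0 * (a 0)\<^sup>2"
  proof (cases "a 0 = 0")
    case True
    then have "a k = 0" for k using decseqD[OF assms(2), of 0 k] assms(1)[of k] by simp
    then show ?thesis by (simp add: T_def)
  next
    case False
    obtain n0 where "T / (4 * (a 0)\<^sup>2) \<le> real n0" using real_arch_simple by blast
    then show ?thesis using False by (intro exI[of _ n0]) (simp add: field_simps)
  qed
  then obtain n0 where n0: "T \<le> 4 * real n0 * (a 0)\<^sup>2" by blast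
  \<comment> \<open>The estimate is obtained for every n > n0, hence for infinitely many n.\<close>
  have bound: "ennreal (1 / (8 * real n)) * (\<Sum>\<^sub>\<infinity>k\<in>{n..}. (approximation_number \<gamma> k)\<^sup>2)
      \<le> (sampling_number \<gamma> n)\<^sup>2" if n: "n \<ge> Suc n0" for n
  proof -
    \<comment> \<open>In \<open>ennreal\<close> the infinite sum is the supremum of its finite
      subsums, and each of these is dominated by a sum over an interval starting at n.\<close>
    have partial: "ennreal (1 / (8 * real n)) * (\<Sum>k\<in>F. (approximation_number \<gamma> k)\<^sup>2) \<le> (sampling_number \<gamma> n)\<^sup>2"
      if F: "finite F" "F \<subseteq> {n..}" for F
    proof -
      obtain M where M: "F \<subseteq> {..<M}" using F(1) finite_nat_iff_bounded by blast
      have "ennreal (1 / (8 * real n)) * (\<Sum>k\<in>F. (approximation_number \<gamma> k)\<^sup>2)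
          = ennreal ((\<Sum>k\<in>F. (a k)\<^sup>2) / (8 * real n))"
        by (simp add: approx assms(1) ennreal_power sum_nonneg flip: ennreal_mult)
      also have "\<dots> \<le> ennreal ((\<Sum>k=n..<M. (a k)\<^sup>2) / (8 * real n))"
        using F M by (intro ennreal_leI divide_right_mono sum_mono2) auto
      also have "\<dots> \<le> (sampling_number \<gamma> n)\<^sup>2"
      proof (rule sampling_number_power2_ge_partial_sum[OF assms(1,2) zz _ refl])
        have "4 * real n0 * (a 0)\<^sup>2 \<le> 4 * real n * (a 0)\<^sup>2"
          using n by (intro mult_right_mono) auto
        then show "(\<Sum>k=n..<M. (a k)\<^sup>2) \<le> 4 * real n * (a 0)\<^sup>2"
          using partial_le[of "{n..<M}"] n0 by simp
      qed (use n in simp)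
      finally show ?thesis .
    qed
    have "(\<Sum>\<^sub>\<infinity>k\<in>{n..}. (approximation_number \<gamma> k)\<^sup>2)
        = (SUP F\<in>{F. finite F \<and> F \<subseteq> {n..}}. \<Sum>k\<in>F. (approximation_number \<gamma> k)\<^sup>2)"
      by (rule nonneg_infsum_complete) simp
    then show ?thesis
      using partial by (auto simp: SUP_mult_left_ennreal intro!: SUP_least)
  qed
  have "infinite {Suc n0..}" by (rule infinite_Ici)
  moreover have "{Suc n0..} \<subseteq> {n. n \<ge> 1 \<and>
      (sampling_number \<gamma> n)\<^sup>2 \<ge> ennreal (1 / (8 * real n)) * (\<Sum>\<^sub>\<infinity>k\<in>{n..}. (approximation_number \<gamma> k)\<^sup>2)}"
    using bound by auto
  ultimately show ?thesis using approx infinite_super by blast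
qed

end
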